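(* Let $a,m$ be positive integers such that $N=5^{2a}m^2$ is a friend of $10$. Then $m$ is not squarefree.
   Context: For a positive integer $n$, $\sigma(n)$ denotes the sum of the positive divisors of $n$ and $I(n)=\sigma(n)/n$. A positive integer $N>10$ is called a friend of $10$ if $I(N)=9/5$. *)

theory Defs
  imports Complex_Main "HOL-Computational_Algebra.Computational_Algebra"
begin

definition divisor_sigma :: "nat \<Rightarrow> nat" where
  "divisor_sigma n = (\<Sum>d | d dvd n. d)"

definition abundancy_index :: "nat \<Rightarrow> rat" where
  "abundancy_index n = of_nat (divisor_sigma n) / of_nat n"

definition friend_of_10 :: "nat \<Rightarrow> bool" where
  "friend_of_10 N \<longleftrightarrow> N > 10 \<and> abundancy_index N = 9 / 5"

end

(* Move any factor 5 of m into the power of 5, so that N = 5^(2b) n^2 with b > 0 and 5 not dividing n.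
   The equation 5 sigma(N) = 9 N then makes 5 divide sigma(5^(2b)) sigma(n^2).  But
   sigma(5^(2b)) = 1 (mod 5), and for squarefree n the other factor is a product of terms
   1 + p + p^2, none of which is divisible by 5 because -3 is not a square modulo 5. *)
theory Submission
  imports Defs
begin

text \<open>Multiplication maps pairs of a divisor of \<open>m\<close> and a divisor of
  \<open>n\<close> bijectively onto the divisors of \<open>m * n\<close>, so the sum over the latter
  factors as a product of two sums.\<close>

lemma divisor_sigma_mult_coprime:
  assumes "coprime m n" "m > 0" "n > 0"
  shows "divisor_sigma (m * n) = divisor_sigma m * divisor_sigma n"
proof -
  let ?f = "\<lambda>(x, y). x * y :: nat"
  have inj: "inj_on ?f ({d. d dvd m} \<times> {d. d dvd n})"
  proof (rule inj_onI, clarsimp)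
    fix x y x' y' :: nat
    assume d: "x dvd m" "y dvd n" "x' dvd m" "y' dvd n" and eq: "x * y = x' * y'"
    \<comment> \<open>Any divisor of \<open>m\<close> is coprime to any divisor of \<open>n\<close>;
      hence \<open>x dvd x' * y'\<close> forces \<open>x dvd x'\<close>, and likewise for the other
      three divisibilities.\<close>
    have c: "coprime x y'" "coprime x' y" "coprime y' x" "coprime y x'"
      using d assms(1) by (meson coprime_divisors coprime_commute)+
    have "x dvd x'" "x' dvd x" "y dvd y'" "y' dvd y"
      using eq coprime_dvd_mult_left_iff[OF c(1), of x'] coprime_dvd_mult_left_iff[OF c(2), of x]
        coprime_dvd_mult_right_iff[OF c(4), of y'] coprime_dvd_mult_right_iff[OF c(3), of y]
      by (metis dvd_triv_left dvd_triv_right)+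
    then show "x = x' \<and> y = y'"
      by (auto intro: dvd_antisym)
  qed
  have "{d. d dvd m * n} = ?f ` ({d. d dvd m} \<times> {d. d dvd n})"
  proof (intro equalityI subsetI)
    fix d assume "d \<in> {d. d dvd m * n}"
    then obtain x y where "d = x * y" "x dvd m" "y dvd n"
      using division_decomp[of d m n] by auto
    then show "d \<in> ?f ` ({d. d dvd m} \<times> {d. d dvd n})" by force
  qed (auto intro: mult_dvd_mono)
  then have "divisor_sigma (m * n) = (\<Sum>(x, y)\<in>{d. d dvd m} \<times> {d. d dvd n}. x * y)"
    using inj by (simp add: divisor_sigma_def sum.reindex case_prod_unfold)
  also have "\<dots> = divisor_sigma m * divisor_sigma n"
    by (simp add: divisor_sigma_def sum_product sum.cartesian_product)
  finally show ?thesis .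
qed

lemma divisor_sigma_prime_power:
  assumes "prime (p :: nat)"
  shows "divisor_sigma (p ^ k) = (\<Sum>i\<le>k. p ^ i)"
proof -
  have "{d. d dvd p ^ k} = (\<lambda>i. p ^ i) ` {..k}"
    using assms by (auto simp: divides_primepow_nat)
  moreover have "inj_on (\<lambda>i. p ^ i) {..k}"
    using prime_gt_1_nat[OF assms] by (auto intro!: inj_onI)
  ultimately show ?thesis
    by (simp add: divisor_sigma_def sum.reindex)
qed

text \<open>Only \<open>p mod 5\<close> matters, and the residues 0 to 4 give the values 1, 3, 7, 13
  and 21.\<close>

lemma not_5_dvd_quadratic: "\<not> 5 dvd 1 + p + p ^ 2" for p :: nat
proof -
  have "p mod 5 = 0 \<or> p mod 5 = 1 \<or> p mod 5 = 2 \<or> p mod 5 = 3 \<or> p mod 5 = 4"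
    by linarith
  then have "(1 + p mod 5 + (p mod 5) ^ 2) mod 5 \<noteq> 0"
    by auto
  also have "(1 + p mod 5 + (p mod 5) ^ 2) mod 5 = (1 + p + p ^ 2) mod 5"
    by (intro mod_add_cong) (simp_all add: power_mod)
  finally show ?thesis
    by (simp add: dvd_eq_mod_eq_0)
qed

text \<open>Otherwise \<open>p ^ 2\<close> would divide \<open>p * k\<close>. This supplies
  coprimality whenever a prime is split off a squarefree number.\<close>

lemma squarefree_prime_mult_not_dvd:
  assumes "squarefree (p * k)" "prime (p :: nat)"
  shows "\<not> p dvd k"
proof
  assume "p dvd k"
  then have "p ^ 2 dvd p * k"
    by (simp add: power2_eq_square mult_dvd_mono)
  with assms show False
    by (auto dest: squarefreeD)
qed

text \<open>Strong induction: splitting off a prime \<open>p\<close> with \<open>m = p * k\<close>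
  contributes the factor \<open>1 + p + p ^ 2\<close>, and \<open>k\<close> is again
  squarefree.\<close>

lemma not_5_dvd_divisor_sigma_square:
  assumes "squarefree (m :: nat)"
  shows "\<not> 5 dvd divisor_sigma (m ^ 2)"
  using assms
proof (induction m rule: less_induct)
  case (less m)
  show ?case
  proof (cases "m = 1")
    case True
    then show ?thesis by (simp add: divisor_sigma_def)
  next
    case False
    then obtain p where p: "prime p" "p dvd m"
      by (meson prime_factor_nat)
    then obtain k where k: "m = p * k" by blast
    \<comment> \<open>Zero is not squarefree, since every square divides it.\<close>
    have "m > 0" using less.prems by (auto intro: Nat.gr0I)
    then have "k > 0" "k < m" using k prime_gt_1_nat[OF p(1)] by auto
    have "\<not> p dvd k"
      using less.prems p(1) k squarefree_prime_mult_not_dvd by blast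
    then have "coprime (p ^ 2) (k ^ 2)"
      using p(1) by (simp add: prime_imp_coprime)
    then have "divisor_sigma (m ^ 2) = divisor_sigma (p ^ 2) * divisor_sigma (k ^ 2)"
      using k \<open>k > 0\<close> p(1) 
      by (simp add: power_mult_distrib divisor_sigma_mult_coprime prime_gt_0_nat)
    moreover have "divisor_sigma (p ^ 2) = 1 + p + p ^ 2"
      unfolding divisor_sigma_prime_power[OF p(1)] by (simp add: numeral_2_eq_2)
    moreover have "squarefree k"
      using less.prems k squarefree_mono[of k m] by simp
    \<comment> \<open>Euclid's lemma for the prime 5; the distributive rules are removed so that the
      product stays unexpanded.\<close>
    ultimately show ?thesis
      using less.IH[of k] \<open>k < m\<close> not_5_dvd_quadratic[of p]
        prime_dvd_mult_nat[of 5 "1 + p + p ^ 2" "divisor_sigma (k ^ 2)"]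
      by (simp del: distrib_right mult_Suc add_mult_distrib)
  qed
qed

theorem theorem1p9:
  fixes a m N :: nat
  assumes "a > 0" and "m > 0"
    and "N = 5 ^ (2 * a) * m ^ 2"
    and "friend_of_10 N"
  shows "\<not> squarefree m"
proof
  assume sf: "squarefree m"
  \<comment> \<open>Squarefreeness allows at most one factor 5 in \<open>m\<close>, so
    \<open>b\<close> is \<open>Suc a\<close> or \<open>a\<close>.\<close>
  obtain b n where bn: "b > 0" "N = 5 ^ (2 * b) * n ^ 2" "\<not> 5 dvd n" "squarefree n"
  proof (cases "5 dvd m")
    case True
    then obtain n where n: "m = 5 * n" by blast
    have "\<not> 5 dvd n"
      using sf n squarefree_prime_mult_not_dvd[of 5 n] by simp
    moreover have "N = 5 ^ (2 * Suc a) * n ^ 2"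
      using assms(3) n by (simp add: power_mult_distrib)
    ultimately show ?thesis
      using that[of "Suc a" n] sf n squarefree_mono[of n m] by simp
  next
    case False
    then show ?thesis using that[of a m] assms sf by auto
  qed
  have "N > 0" using assms by simp
  then have "n > 0" using bn by (auto intro: Nat.gr0I)
  have "coprime (5 ^ (2 * b)) (n ^ 2)"
    using bn by (simp add: prime_imp_coprime)
  then have sigma: "divisor_sigma N = divisor_sigma (5 ^ (2 * b)) * divisor_sigma (n ^ 2)"
    using bn \<open>n > 0\<close> by (simp add: divisor_sigma_mult_coprime)
  have "of_nat (5 * divisor_sigma N) = (of_nat (9 * N) :: rat)"
    using assms(4) \<open>N > 0\<close> by (simp add: friend_of_10_def abundancy_index_def field_simps)
  then have eq: "5 * divisor_sigma N = 9 * N"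
    unfolding of_nat_eq_iff .
  \<comment> \<open>Since \<open>b > 0\<close>, 25 divides \<open>N\<close>; one factor 5 survives
    after cancelling the 5 on the left of \<open>eq\<close>.\<close>
  have "(5 :: nat) ^ 2 dvd 5 ^ (2 * b)"
    using bn by (intro le_imp_power_dvd) auto
  then have "5 * 5 dvd 5 * divisor_sigma N"
    using eq bn by (simp add: power2_eq_square)
  then have "5 dvd divisor_sigma N" 
    unfolding dvd_mult_cancel_left by simp
  moreover have "\<not> 5 dvd divisor_sigma (5 ^ (2 * b))"
  proof -
    \<comment> \<open>The term for exponent 0 is split off; every other term has a factor 5.\<close>
    have "divisor_sigma (5 ^ (2 * b)) = 1 + 5 * (\<Sum>i<2 * b. 5 ^ i)"
      by (simp add: divisor_sigma_prime_power sum.atMost_shift sum_distrib_left)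
    then show ?thesis by presburger
  qed
  ultimately show False
    using sigma not_5_dvd_divisor_sigma_square[OF bn(4)]
    by (simp add: prime_dvd_mult_iff)
qed

end
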